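(* Let $R$ be an integral domain. Then $GCl_{int}(R)$ is complete if and only if $R$ is a Noetherian valuation domain.
   Context: $GCl_{int}(R)$ is the simple undirected graph whose vertices are the nonzero ideals of $R$ (including $R$ itself), with an edge between two distinct nonzero ideals if and only if, for one of the two orderings $(I,J)$ of the pair, there is a nonzero $a\in R$ such that $I=Ja$. *)

theory Defs
  imports "HOL-Algebra.Algebra" "HOL-Library.Ramsey"
begin

text \<open>
  A simple graph is given by its vertex set and its set of two-element edges, the convention of
  \<^theory>\<open>HOL-Library.Ramsey\<close>.  As usual in HOL-Algebra, \<open>J #> a\<close> is formed in the
  multiplicative monoid of the ring: it is \<open>{j \<otimes> a | j \<in> J}\<close>, not an additive coset.
\<close>

definition GCl_int_verts :: "('a, 'b) ring_scheme \<Rightarrow> 'a set set" where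
  "GCl_int_verts R = {I. ideal I R \<and> I \<noteq> {\<zero>\<^bsub>R\<^esub>}}"

definition GCl_int_edges :: "('a, 'b) ring_scheme \<Rightarrow> 'a set set set" where
  "GCl_int_edges R =
    {{I, J} | I J. I \<in> GCl_int_verts R \<and> J \<in> GCl_int_verts R \<and> I \<noteq> J \<and>
      (\<exists>a \<in> carrier R - {\<zero>\<^bsub>R\<^esub>}. I = J #>\<^bsub>R\<^esub> a)}"

definition complete_graph :: "'v set \<Rightarrow> 'v set set \<Rightarrow> bool" where
  "complete_graph V E \<longleftrightarrow> E \<subseteq> [V]\<^bsup>2\<^esup> \<and> clique V E"

text \<open>
  A field counts as a valuation domain.  For a nonzero element \<open>x = a/b\<close> of the quotient
  field, \<open>x\<close> lies in the domain iff \<open>b\<close> divides \<open>a\<close>, and its inverse does iff \<open>a\<close> divides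
  \<open>b\<close>; the lemma below relates the two formulations.
\<close>

locale valuation_domain = domain +
  assumes divides_total:
    "a \<in> carrier R \<Longrightarrow> b \<in> carrier R \<Longrightarrow> a divides\<^bsub>R\<^esub> b \<or> b divides\<^bsub>R\<^esub> a"

lemma valuation_domain_iff_quotient_field:
  fixes K (structure)
  assumes K: "field K" and V: "subring V K"
    and quot: "\<And>x. x \<in> carrier K \<Longrightarrow> \<exists>a \<in> V. \<exists>b \<in> V - {\<zero>}. x = a \<otimes> inv b"
  shows "valuation_domain (K\<lparr>carrier := V\<rparr>) \<longleftrightarrow>
    (\<forall>x \<in> carrier K - {\<zero>}. x \<in> V \<or> inv x \<in> V)"
proof -
  interpret K: field K by fact
  have sub: "V \<subseteq> carrier K" using V subringE(1) by blast
  have dom: "domain (K\<lparr>carrier := V\<rparr>)"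
    using V K.subdomainI' K.subdomain_is_domain by blast
  have unit: "inv c \<in> carrier K" "c \<otimes> inv c = \<one>" "inv c \<otimes> c = \<one>" "inv c \<noteq> \<zero>"
    if "c \<in> carrier K - {\<zero>}" for c
    using that K.field_Units K.Units_inv_closed K.Units_r_inv K.Units_l_inv K.Units_inv_Units
    by auto
  have div: "b divides\<^bsub>K\<lparr>carrier := V\<rparr>\<^esub> a \<longleftrightarrow> a \<otimes> inv b \<in> V"
    if "a \<in> V" "b \<in> V - {\<zero>}" for a b
  proof -
    have c: "a \<in> carrier K" "b \<in> carrier K - {\<zero>}" using that sub by auto
    have "a = b \<otimes> z \<longleftrightarrow> z = a \<otimes> inv b" if "z \<in> carrier K" for z
    proof
      assume "a = b \<otimes> z"
      then have "a \<otimes> inv b = z \<otimes> (b \<otimes> inv b)"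
        using c that unit(1)[OF c(2)] by (simp add: K.m_ac)
      then show "z = a \<otimes> inv b" using that unit(2)[OF c(2)] by simp
    next
      assume "z = a \<otimes> inv b"
      then have "b \<otimes> z = a \<otimes> (b \<otimes> inv b)"
        using c unit(1)[OF c(2)] by (simp add: K.m_ac)
      then show "a = b \<otimes> z" using c unit(2)[OF c(2)] by simp
    qed
    then have "(\<exists>z\<in>V. a = b \<otimes> z) \<longleftrightarrow> (\<exists>z\<in>V. z = a \<otimes> inv b)"
      using sub by (intro bex_cong refl) blast
    then show ?thesis by (simp add: factor_def)
  qed
  have inv_quot: "inv (a \<otimes> inv b) = b \<otimes> inv a"
    if "a \<in> carrier K - {\<zero>}" "b \<in> carrier K - {\<zero>}" for a b
  proof (rule K.comm_inv_char)
    show "a \<otimes> inv b \<in> carrier K" "b \<otimes> inv a \<in> carrier K"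
      using that unit(1) by auto
    have "(a \<otimes> inv b) \<otimes> (b \<otimes> inv a) = (a \<otimes> inv a) \<otimes> (b \<otimes> inv b)"
      using that unit(1)[OF that(1)] unit(1)[OF that(2)] by (simp add: K.m_ac)
    then show "(a \<otimes> inv b) \<otimes> (b \<otimes> inv a) = \<one>"
      using unit(2)[OF that(1)] unit(2)[OF that(2)] by simp
  qed
  have zero: "a divides\<^bsub>K\<lparr>carrier := V\<rparr>\<^esub> \<zero>" if "a \<in> V" for a
    using that V sub subringE(2)[OF V] by (auto simp: factor_def intro!: bexI[of _ \<zero>])
  show ?thesis
  proof
    assume "valuation_domain (K\<lparr>carrier := V\<rparr>)"
    then interpret W: valuation_domain "K\<lparr>carrier := V\<rparr>" .
    show "\<forall>x \<in> carrier K - {\<zero>}. x \<in> V \<or> inv x \<in> V"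
    proof
      fix x assume x: "x \<in> carrier K - {\<zero>}"
      then obtain a b where ab: "a \<in> V" "b \<in> V - {\<zero>}" "x = a \<otimes> inv b" using quot by blast
      have c: "a \<in> carrier K" "b \<in> carrier K - {\<zero>}" using ab sub by auto
      have a0: "a \<noteq> \<zero>" using x ab(3) unit(1)[OF c(2)] by auto
      have "b divides\<^bsub>K\<lparr>carrier := V\<rparr>\<^esub> a \<or> a divides\<^bsub>K\<lparr>carrier := V\<rparr>\<^esub> b"
        by (rule W.divides_total) (use ab(1,2) in simp_all)
      then have "a \<otimes> inv b \<in> V \<or> b \<otimes> inv a \<in> V"
        using div[OF ab(1,2)] div[of b a] ab(1,2) a0 by blast
      moreover have "inv x = b \<otimes> inv a" unfolding ab(3) by (rule inv_quot) (use c a0 in simp_all)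
      ultimately show "x \<in> V \<or> inv x \<in> V" using ab(3) by simp
    qed
  next
    assume *: "\<forall>x \<in> carrier K - {\<zero>}. x \<in> V \<or> inv x \<in> V"
    show "valuation_domain (K\<lparr>carrier := V\<rparr>)"
    proof (rule valuation_domain.intro[OF dom], unfold_locales)
      fix a b assume "a \<in> carrier (K\<lparr>carrier := V\<rparr>)" "b \<in> carrier (K\<lparr>carrier := V\<rparr>)"
      then have ab: "a \<in> V" "b \<in> V" by auto
      show "a divides\<^bsub>K\<lparr>carrier := V\<rparr>\<^esub> b \<or> b divides\<^bsub>K\<lparr>carrier := V\<rparr>\<^esub> a"
      proof (cases "a = \<zero> \<or> b = \<zero>")
        case True
        then show ?thesis using zero ab by auto
      next
        case False
        then have c: "a \<in> carrier K - {\<zero>}" "b \<in> carrier K - {\<zero>}" using ab sub by auto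
        have "a \<otimes> inv b \<in> carrier K - {\<zero>}"
          using c unit[OF c(2)] K.integral_iff by auto
        then have "a \<otimes> inv b \<in> V \<or> b \<otimes> inv a \<in> V"
          using * inv_quot[OF c] by force
        then show ?thesis using div[of a b] div[of b a] ab False by blast
      qed
    qed
  qed
qed

end

theory Submission
  imports Defs
begin

text \<open>
  Both sides say that \<open>R\<close> is a principal ideal domain whose elements are totally ordered by
  divisibility.

  Compare a proper nonzero ideal \<open>I\<close> with the vertex \<open>R\<close> itself.  Since \<open>Ia \<subseteq> I\<close>, the
  relation \<open>R = Ia\<close> is impossible, so adjacency forces \<open>I = Ra\<close>: if the graph is complete, then
  every ideal is principal, and \<open>R\<close> is Noetherian (\<open>complete_imp_principal_domain\<close>).
  For nonzero \<open>a\<close> and \<open>b\<close>, the ideals \<open>Ra\<close> and \<open>Rb\<close> are equal or adjacent.  In both cases one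
  contains the other, that is, one of the generators divides the other
  (\<open>complete_imp_valuation_domain\<close>).

  Conversely, in a valuation domain a finite nonempty set has an element dividing all the
  others, so that a Noetherian valuation domain is principal
  (\<open>noetherian_valuation_imp_principal\<close>).  If \<open>I = Rx\<close>, \<open>J = Ry\<close> are nonzero and, say, \<open>y = xc\<close>,
  then \<open>J = Ic\<close> with \<open>c \<noteq> 0\<close>.
\<close>

text \<open>
  Edges join distinct vertices by construction, so completeness amounts to a relation between
  any two distinct nonzero ideals; as edges are unordered, either ideal may be the multiple.
\<close>

lemma complete_GCl_int_iff:
  fixes R (structure)
  shows "complete_graph (GCl_int_verts R) (GCl_int_edges R) \<longleftrightarrow>
    (\<forall>I J. ideal I R \<longrightarrow> I \<noteq> {\<zero>} \<longrightarrow> ideal J R \<longrightarrow> J \<noteq> {\<zero>} \<longrightarrow> I \<noteq> J \<longrightarrow>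
      (\<exists>a \<in> carrier R - {\<zero>}. I = J #> a \<or> J = I #> a))"
proof -
  have sub: "GCl_int_edges R \<subseteq> [GCl_int_verts R]\<^bsup>2\<^esup>"
    unfolding GCl_int_edges_def by auto
  have intro_edge: "{I, J} \<in> GCl_int_edges R"
    if "I \<in> GCl_int_verts R" "J \<in> GCl_int_verts R" "I \<noteq> J"
      "\<exists>a \<in> carrier R - {\<zero>}. I = J #> a" for I J
    unfolding GCl_int_edges_def mem_Collect_eq
    by (rule exI[of _ I], rule exI[of _ J]) (intro conjI refl that)
  have edge: "{I, J} \<in> GCl_int_edges R \<longleftrightarrow> (\<exists>a \<in> carrier R - {\<zero>}. I = J #> a \<or> J = I #> a)"
    if "I \<in> GCl_int_verts R" "J \<in> GCl_int_verts R" "I \<noteq> J" for I J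
  proof
    assume "{I, J} \<in> GCl_int_edges R"
    then have "\<exists>K L. {I, J} = {K, L} \<and> (\<exists>a \<in> carrier R - {\<zero>}. K = L #> a)"
      unfolding GCl_int_edges_def mem_Collect_eq by meson
    then obtain K L where "{I, J} = {K, L}" and KL: "\<exists>a \<in> carrier R - {\<zero>}. K = L #> a"
      by (elim exE conjE)
    then have "I = K \<and> J = L \<or> I = L \<and> J = K"
      by (simp only: doubleton_eq_iff)
    then show "\<exists>a \<in> carrier R - {\<zero>}. I = J #> a \<or> J = I #> a"
      using KL by blast
  next
    assume "\<exists>a \<in> carrier R - {\<zero>}. I = J #> a \<or> J = I #> a"
    then consider "\<exists>a \<in> carrier R - {\<zero>}. I = J #> a" | "\<exists>a \<in> carrier R - {\<zero>}. J = I #> a"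
      by blast
    then show "{I, J} \<in> GCl_int_edges R"
    proof cases
      case 1
      then show ?thesis using intro_edge[of I J] that by blast
    next
      case 2
      then have "{J, I} \<in> GCl_int_edges R" using intro_edge[of J I] that by blast
      then show ?thesis by (simp only: insert_commute)
    qed
  qed
  have "complete_graph (GCl_int_verts R) (GCl_int_edges R) \<longleftrightarrow>
    (\<forall>I \<in> GCl_int_verts R. \<forall>J \<in> GCl_int_verts R. I \<noteq> J \<longrightarrow> {I, J} \<in> GCl_int_edges R)"
    using sub by (simp add: complete_graph_def clique_def)
  also have "\<dots> \<longleftrightarrow> (\<forall>I \<in> GCl_int_verts R. \<forall>J \<in> GCl_int_verts R. I \<noteq> J \<longrightarrow>
      (\<exists>a \<in> carrier R - {\<zero>}. I = J #> a \<or> J = I #> a))"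
    using edge by blast
  finally show ?thesis
    unfolding GCl_int_verts_def by blast
qed

lemma (in cring) cgenideal_r_coset:
  assumes "x \<in> carrier R" "c \<in> carrier R"
  shows "PIdl x #> c = PIdl (x \<otimes> c)"
  using assms by (auto simp: cgenideal_def r_coset_def m_assoc)

lemma (in cring) ideal_r_coset_subset:
  assumes "ideal I R" "c \<in> carrier R"
  shows "I #> c \<subseteq> I"
  using assms ideal.I_r_closed by (fastforce simp: r_coset_def)

lemma (in domain) complete_imp_principal_domain:
  assumes "complete_graph (GCl_int_verts R) (GCl_int_edges R)"
  shows "principal_domain R"
proof unfold_locales
  fix I assume I: "ideal I R"
  consider "I = {\<zero>}" | "I = carrier R" | "I \<noteq> {\<zero>}" "I \<noteq> carrier R" by blast
  then show "\<exists>a \<in> carrier R. I = PIdl a"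
  proof cases
    case 1
    then show ?thesis
      using cgenideal_eq_genideal[of \<zero>] genideal_zero by auto
  next
    case 2
    then show ?thesis
      using cgenideal_eq_genideal[of \<one>] genideal_one by auto
  next
    case 3
    have "carrier R \<noteq> {\<zero>}" using one_closed one_not_zero by blast
    with 3 obtain a where a: "a \<in> carrier R" "I = carrier R #> a \<or> carrier R = I #> a"
      using assms I oneideal unfolding complete_GCl_int_iff by blast
    \<comment> \<open>A multiple of \<open>I\<close> stays inside the proper ideal \<open>I\<close>.\<close>
    have "carrier R \<noteq> I #> a"
      using ideal_r_coset_subset[OF I a(1)] 3(2) ideal.Icarr[OF I] by blast
    then show ?thesis
      using a cgenideal_eq_rcos by blast
  qed
qed

lemma (in domain) complete_imp_valuation_domain:
  assumes "complete_graph (GCl_int_verts R) (GCl_int_edges R)"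
  shows "valuation_domain R"
proof unfold_locales
  fix a b assume ab: "a \<in> carrier R" "b \<in> carrier R"
  have gen: "ideal (PIdl x) R" "x \<in> PIdl x" if "x \<in> carrier R" for x
    using that cgenideal_ideal cgenideal_self by auto
  have "PIdl a \<subseteq> PIdl b \<or> PIdl b \<subseteq> PIdl a"
    \<comment> \<open>The zero ideal is not a vertex, and a vertex is not adjacent to itself.\<close>
  proof (cases "PIdl a = {\<zero>} \<or> PIdl b = {\<zero>} \<or> PIdl a = PIdl b")
    case True
    moreover have "{\<zero>} \<subseteq> PIdl a" "{\<zero>} \<subseteq> PIdl b"
      using gen(1)[THEN ideal.axioms(1), THEN additive_subgroup.zero_closed] ab by simp_all
    ultimately show ?thesis by force
  next
    case False
    have "\<exists>c \<in> carrier R - {\<zero>}. PIdl a = PIdl b #> c \<or> PIdl b = PIdl a #> c"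
      using assms[unfolded complete_GCl_int_iff, rule_format, OF gen(1) _ gen(1)] ab False by simp
    then obtain c where c: "c \<in> carrier R" "PIdl a = PIdl b #> c \<or> PIdl b = PIdl a #> c"
      by blast
    then show ?thesis
      using ideal_r_coset_subset[OF gen(1)[OF ab(1)] c(1)]
        ideal_r_coset_subset[OF gen(1)[OF ab(2)] c(1)] by auto
  qed
  then show "a divides b \<or> b divides a"
    using to_contain_is_to_divide ab by blast
qed

text \<open>
  A finite nonempty set that is totally preordered by divisibility has a least element.  The
  witness \<open>\<zero>\<close> is admitted to cover the empty set, whose generated ideal is also that of \<open>\<zero>\<close>.
\<close>

lemma (in valuation_domain) finite_least_divisor:
  assumes "finite A" "A \<subseteq> carrier R"
  shows "\<exists>a \<in> insert \<zero> A. \<forall>b \<in> A. a divides b"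
  using assms
proof (induction A)
  case empty
  then show ?case by simp
next
  case (insert x A)
  then obtain a where a: "a \<in> insert \<zero> A" "\<forall>b \<in> A. a divides b" by auto
  have car: "a \<in> carrier R" "x \<in> carrier R" using a insert.prems by auto
  show ?case
  proof (cases "a divides x")
    case True
    then show ?thesis using a by auto
  next
    case False
    then have "x divides a" using divides_total car by blast
    then have "\<forall>b \<in> insert x A. x divides b"
      using a(2) divides_trans divides_refl car by blast
    then show ?thesis by blast
  qed
qed

lemma noetherian_valuation_imp_principal:
  fixes R (structure)
  assumes "noetherian_ring R" "valuation_domain R"
  shows "principal_domain R"
proof -
  interpret noetherian_ring R by fact
  interpret valuation_domain R by fact
  show ?thesis
  proof unfold_locales
    fix I assume "ideal I R"
    then obtain A where A: "A \<subseteq> carrier R" "finite A" "I = Idl A"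
      using finetely_gen by blast
    then obtain a where a: "a \<in> insert \<zero> A" "\<forall>b \<in> A. a divides b"
      using finite_least_divisor by blast
    have car: "a \<in> carrier R" using a(1) A(1) by auto
    have "a \<in> I"
      using a(1) genideal_self[OF A(1)] A(3)
        additive_subgroup.zero_closed[OF ideal.axioms(1)[OF \<open>ideal I R\<close>]] by auto
    then have "PIdl a \<subseteq> I"
      using cgenideal_minimal \<open>ideal I R\<close> by blast
    moreover have "A \<subseteq> PIdl a"
      using a(2) A(1) car m_comm by (fastforce simp: factor_def cgenideal_def)
    then have "I \<subseteq> PIdl a"
      using genideal_minimal cgenideal_ideal[OF car] A(3) by blast
    ultimately show "\<exists>a \<in> carrier R. I = PIdl a"
      using car by blast
  qed
qed

theorem theorem4p2:
  fixes R :: "('a, 'b) ring_scheme" (structure)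
  assumes "domain R"
  shows "complete_graph (GCl_int_verts R) (GCl_int_edges R) \<longleftrightarrow>
    noetherian_domain R \<and> valuation_domain R"
proof
  interpret domain R by fact
  assume complete: "complete_graph (GCl_int_verts R) (GCl_int_edges R)"
  then interpret principal_domain R by (rule complete_imp_principal_domain)
  show "noetherian_domain R \<and> valuation_domain R"
    using noetherian_domain_axioms complete_imp_valuation_domain[OF complete] by blast
next
  assume R: "noetherian_domain R \<and> valuation_domain R"
  then interpret valuation_domain R by blast
  interpret principal_domain R
    using R noetherian_valuation_imp_principal noetherian_domain.axioms(1) by blast
  have multiple: "\<exists>c \<in> carrier R - {\<zero>}. PIdl y = PIdl x #> c"
    if "x \<in> carrier R" "PIdl y \<noteq> {\<zero>}" "x divides y" for x y
  proof -
    obtain c where c: "c \<in> carrier R" "y = x \<otimes> c"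
      using \<open>x divides y\<close> by (auto simp: factor_def)
    have "PIdl \<zero> = {\<zero>}"
      using cgenideal_eq_genideal[of \<zero>] genideal_zero by simp
    then have "y \<noteq> \<zero>" using that(2) by metis
    then have "c \<noteq> \<zero>" using c(2) r_null[OF that(1)] by metis
    moreover have "PIdl y = PIdl x #> c"
      using cgenideal_r_coset[OF that(1) c(1)] c(2) by simp
    ultimately show ?thesis using c(1) by blast
  qed
  show "complete_graph (GCl_int_verts R) (GCl_int_edges R)"
    unfolding complete_GCl_int_iff
  proof (intro allI impI)
    fix I J assume IJ: "ideal I R" "I \<noteq> {\<zero>}" "ideal J R" "J \<noteq> {\<zero>}"
    obtain x y where xy: "x \<in> carrier R" "I = PIdl x" "y \<in> carrier R" "J = PIdl y"
      using exists_gen IJ by meson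
    show "\<exists>a \<in> carrier R - {\<zero>}. I = J #> a \<or> J = I #> a"
      using divides_total[OF xy(1,3)] multiple[OF xy(1)] multiple[OF xy(3)] IJ(2,4)
      unfolding xy(2,4) by blast
  qed
qed

end
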